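(* Let $a,b,c,d,e,f$ be positive integers with $a,b,c$ even and $d,e,f$ odd such that $a^2+b^2=c^2$, $a^2+d^2=e^2$, $b^2+d^2=f^2$. Let $x_2=\sqrt{\frac{e+d}{2}}$ and $y_2=\sqrt{\frac{e-d}{2}}$ (so $a=2x_2y_2$, $d=x_2^2-y_2^2$, $e=x_2^2+y_2^2$), and suppose that $x_2^4$ and $y_2^4$ are integers. Then on the curves $$y^2=x^3-(x_2^4-y_2^4)\,x\qquad\text{and}\qquad y^2=(x_2^4+y_2^4)\,x-x^3$$ there is no point from which a right triangle with integer or rational sides can be constructed. That is, neither curve contains a real point $(x,y)$ with $y\neq 0$ for which the three numbers $$A=\frac{x^2-n^2}{y},\qquad B=\frac{2nx}{y},\qquad C=\frac{x^2+n^2}{y}$$ are all rational, where $n=\sqrt{x_2^4-y_2^4}$ for the first curve and $n=\sqrt{x_2^4+y_2^4}$ for the second curve.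
   Context: The right triangle constructed from a point $(x,y)$, $y\ne 0$, on one of the curves $y^2=x^3-n^2x$ or $y^2=n^2x-x^3$ ($n>0$) is the triangle with sides (up to sign) $A=(x^2-n^2)/y$, $B=2nx/y$, $C=(x^2+n^2)/y$, which satisfy $A^2+B^2=C^2$. The integers $a,b,d$ are the edges of a cuboid and $c,e,f$ its face diagonals; the pair $(x_2,y_2)$ is called the pair of numbers forming the right triangle $a^2+d^2=e^2$. *)

theory Defs
  imports Complex_Main
begin

definition tri_A :: "real \<Rightarrow> real \<Rightarrow> real \<Rightarrow> real" where
  "tri_A n x y = (x\<^sup>2 - n\<^sup>2) / y"

definition tri_B :: "real \<Rightarrow> real \<Rightarrow> real \<Rightarrow> real" where
  "tri_B n x y = 2 * n * x / y"

definition tri_C :: "real \<Rightarrow> real \<Rightarrow> real \<Rightarrow> real" where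
  "tri_C n x y = (x\<^sup>2 + n\<^sup>2) / y"

(* Sides are taken up to sign, so they may be negative, and may be integers,
   since \<int> is contained in \<rat>.  The conjunct y \<noteq> 0 is needed because
   division by 0 yields 0. *)
definition rational_right_triangle_from :: "real \<Rightarrow> real \<Rightarrow> real \<Rightarrow> bool" where
  "rational_right_triangle_from n x y \<longleftrightarrow>
     y \<noteq> 0 \<and> tri_A n x y \<in> \<rat> \<and> tri_B n x y \<in> \<rat> \<and> tri_C n x y \<in> \<rat>"

end

theory Submission
  imports Defs "HOL-Computational_Algebra.Nth_Powers"
begin

text \<open>
  On either curve \<open>A * B = \<plusminus> 2 * n\<close>, so rational sides force \<open>n\<close> to be
  rational, hence an integer. With \<open>X = x2\<^sup>2\<close> and \<open>Y = y2\<^sup>2\<close> we have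
  \<open>X * Y = (a / 2)\<^sup>2\<close> and \<open>X\<^sup>2 - Y\<^sup>2 = n\<^sup>2\<close> or \<open>X\<^sup>2 + Y\<^sup>2 = n\<^sup>2\<close>; after
  division by \<open>gcd X Y\<close> both \<open>X\<close> and \<open>Y\<close> are squares, which contradicts
  Fermat's theorems that \<open>s ^ 4 - t ^ 4\<close> and \<open>s ^ 4 + t ^ 4\<close> are not squares
  for positive \<open>s\<close>, \<open>t\<close>.
\<close>

section \<open>Squares and Pythagorean triples in the natural numbers\<close>

lemma coprime_mult_eq_square_nat:
  fixes a b c :: nat
  assumes "coprime a b" "a * b = c\<^sup>2"
  obtains s t where "a = s\<^sup>2" "b = t\<^sup>2"
proof -
  have "is_nth_power 2 (a * b)"
    using assms(2) by (auto simp: is_nth_power_def)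
  then have "is_nth_power 2 a" "is_nth_power 2 b"
    using assms(1) by (auto simp: is_nth_power_mult_coprime_nat_iff)
  then show ?thesis
    using that by (auto simp: is_nth_power_def)
qed

text \<open>Since \<open>m\<close> is odd, it is coprime to \<open>2 * n\<close> too, so both
  factors of \<open>m * (2 * n) = c^2\<close> are squares, the second an even one. Both descents
  below apply this to \<open>y^2 = 2 * m * n\<close>.\<close>

lemma coprime_even_double_mult_eq_square_nat:
  fixes m n c :: nat
  assumes "coprime m n" "even n" "c\<^sup>2 = 2 * m * n"
  obtains s r where "m = s\<^sup>2" "n = 2 * r\<^sup>2"
proof -
  have "odd m"
    using assms(1,2) coprime_common_divisor_nat[of m n 2] by auto
  then have "coprime m (2 * n)"
    using assms(1) by simp
  moreover have "m * (2 * n) = c\<^sup>2"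
    using assms(3) by simp
  ultimately obtain s t where st: "m = s\<^sup>2" "2 * n = t\<^sup>2"
    by (rule coprime_mult_eq_square_nat)
  then have "even (t\<^sup>2)" by (metis dvd_triv_left)
  then have "even t" by simp
  then obtain r where "t = 2 * r" by blast
  with st show ?thesis
    using that[of s r] by (simp add: power2_eq_square)
qed

lemma odd_square_mod_4_nat: "odd x \<Longrightarrow> x\<^sup>2 mod 4 = 1" for x :: nat
  by (auto elim!: oddE simp: power2_eq_square algebra_simps mod_Suc)

text \<open>Modulo 4 the sum is 2, which no square is. This supplies the even leg that the
  parametrisation of Pythagorean triples asks for.\<close>

lemma odd_squares_sum_not_square_nat:
  fixes a b c :: nat
  assumes "odd a" "odd b"
  shows "a\<^sup>2 + b\<^sup>2 \<noteq> c\<^sup>2"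
proof
  assume eq: "a\<^sup>2 + b\<^sup>2 = c\<^sup>2"
  have "a\<^sup>2 mod 4 = 1" "b\<^sup>2 mod 4 = 1"
    using assms odd_square_mod_4_nat by auto
  then have "(a\<^sup>2 + b\<^sup>2) mod 4 = 2" by presburger
  moreover have "c\<^sup>2 mod 4 \<noteq> 2"
  proof (cases "even c")
    case True
    then show ?thesis by (auto elim!: evenE simp: power2_eq_square)
  qed (simp add: odd_square_mod_4_nat)
  ultimately show False using eq by simp
qed

text \<open>With \<open>c = a + 2 * v\<close> and \<open>b = 2 * w\<close> the equation becomes
  \<open>(a + v) * v = w^2\<close> with coprime factors, so these are squares \<open>m^2\<close> and
  \<open>n^2\<close>. Writing \<open>a + n^2 = m^2\<close> avoids truncated subtraction.\<close>

lemma pythagorean_triple_nat: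
  fixes a b c :: nat
  assumes "coprime a b" "even b" "a\<^sup>2 + b\<^sup>2 = c\<^sup>2"
  obtains m n where "coprime m n" "a + n\<^sup>2 = m\<^sup>2" "b = 2 * m * n" "c = m\<^sup>2 + n\<^sup>2" "odd (m + n)"
proof -
  have "odd a"
    using assms(1,2) coprime_common_divisor_nat[of a b 2] by auto
  then have "odd c"
    using assms(2,3) by (metis even_add even_power zero_less_numeral)
  have "a\<^sup>2 \<le> c\<^sup>2" using assms(3) by linarith
  then have "a \<le> c" by (rule power2_le_imp_le) simp
  then obtain k where k: "c = a + k" using le_Suc_ex by blast
  then have "even k" using \<open>odd a\<close> \<open>odd c\<close> by simp
  then obtain v where v: "k = 2 * v" by blast
  obtain w where w: "b = 2 * w" using assms(2) by blast
  have prod: "(a + v) * v = w\<^sup>2"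
    using assms(3) unfolding k v w by (simp add: power2_eq_square algebra_simps)
  have "coprime a (w\<^sup>2)" using assms(1) w by simp
  then have "coprime a v" by (simp flip: prod)
  then have "coprime (a + v) v" by (simp add: coprime_iff_gcd_eq_1)
  then obtain m n where mn: "a + v = m\<^sup>2" "v = n\<^sup>2"
    using prod by (rule coprime_mult_eq_square_nat)
  have "w\<^sup>2 = (m * n)\<^sup>2"
    using prod mn by (simp add: power_mult_distrib)
  then have b: "b = 2 * m * n" using w by simp
  have c: "c = m\<^sup>2 + n\<^sup>2" using k v mn by simp
  have "coprime m n"
    using \<open>coprime (a + v) v\<close> mn by simp
  moreover have "odd (m + n)"
    using \<open>odd c\<close> c by simp
  ultimately show ?thesis
    using that mn b c by simp
qed

section \<open>Fermat's descents for sums and differences of fourth powers\<close>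

text \<open>Infinite descent on \<open>z\<close>: the triple \<open>(x^2, y^2, z)\<close> is
  parametrised by \<open>m\<close> and \<open>n\<close>, then the triple \<open>(x, n, m)\<close> by
  \<open>p\<close> and \<open>q\<close>. Since \<open>m\<close>, \<open>p\<close> and
  \<open>q\<close> turn out to be squares, \<open>m = p^2 + q^2\<close> is a smaller
  solution.\<close>

theorem fermat_sum_fourth_powers_nat:
  fixes x y z :: nat
  assumes "coprime x y" "x > 0" "y > 0"
  shows "x ^ 4 + y ^ 4 \<noteq> z\<^sup>2"
  using assms
proof (induction z arbitrary: x y rule: less_induct)
  case (less z)
  show ?case
  proof
    assume eq: "x ^ 4 + y ^ 4 = z\<^sup>2"
    \<comment> \<open>Stated for fresh \<open>x\<close> and \<open>y\<close> with \<open>y\<close>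
      even, so that it can be used in either order of the original pair.\<close>
    have descent: False
      if xy: "coprime x y" "x > 0" "y > 0" "even y" and eq: "x ^ 4 + y ^ 4 = z\<^sup>2" for x y
    proof -
      have "(x\<^sup>2)\<^sup>2 + (y\<^sup>2)\<^sup>2 = z\<^sup>2" using eq by (simp flip: power_mult)
      moreover have "coprime (x\<^sup>2) (y\<^sup>2)" "even (y\<^sup>2)" using xy by auto
      ultimately obtain m n where mn: "coprime m n" "x\<^sup>2 + n\<^sup>2 = m\<^sup>2"
        "y\<^sup>2 = 2 * m * n" "z = m\<^sup>2 + n\<^sup>2"
        by (metis pythagorean_triple_nat)
      have pos: "m > 0" "n > 0" using mn(3) \<open>y > 0\<close> by (auto intro!: Nat.gr0I)
      have "odd x"
        using xy coprime_common_divisor_nat[of x y 2] by auto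
      then have "even n"
        using mn(2) odd_squares_sum_not_square_nat by blast
      obtain s r where sr: "m = s\<^sup>2" "n = 2 * r\<^sup>2"
        using coprime_even_double_mult_eq_square_nat[OF mn(1) \<open>even n\<close> mn(3)] .
      \<comment> \<open>As \<open>x^2 + n^2 = m^2\<close>, coprimality passes from \<open>m\<close>,
        \<open>n\<close> to \<open>x\<close>, \<open>n\<close>, which permits the second
        parametrisation.\<close>
      have "coprime (x\<^sup>2 + n\<^sup>2) (n\<^sup>2)" using mn(1,2) by simp
      then have "coprime (x\<^sup>2) (n\<^sup>2)" by (simp only: coprime_iff_gcd_eq_1 gcd_add1)
      then have "coprime x n" by simp
      then obtain p q where pq: "coprime p q" "n = 2 * p * q" "m = p\<^sup>2 + q\<^sup>2"
        using \<open>even n\<close> mn(2) by (metis pythagorean_triple_nat)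
      have "p * q = r\<^sup>2" using pq sr by simp
      with pq(1) obtain P Q where PQ: "p = P\<^sup>2" "q = Q\<^sup>2"
        by (rule coprime_mult_eq_square_nat)
      have "P ^ 4 + Q ^ 4 = s\<^sup>2"
        using pq(3) sr(1) PQ by (simp flip: power_mult)
      moreover have "coprime P Q" "P > 0" "Q > 0"
        using pq pos PQ by (auto intro!: Nat.gr0I)
      moreover have "s < z"
      proof -
        have "s \<le> m" unfolding sr(1) by (simp add: power2_eq_square)
        also have "m \<le> m\<^sup>2" by (simp add: power2_eq_square)
        also have "m\<^sup>2 < z" using mn(4) pos by simp
        finally show ?thesis .
      qed
      ultimately show False using less.IH by blast
    qed
    have "even x \<or> even y"
      using odd_squares_sum_not_square_nat[of "x\<^sup>2" "y\<^sup>2" z] eq by (auto simp flip: power_mult)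
    then show False
      using descent[of x y] descent[of y x] less.prems eq
      by (auto simp: coprime_commute add.commute)
  qed
qed

text \<open>Infinite descent on \<open>x\<close> through the triple \<open>(y^2, z, x^2)\<close>. If
  \<open>z\<close> is the even leg, one parametrisation already gives a smaller solution; if
  \<open>y^2\<close> is, a second one is needed.\<close>

theorem fermat_diff_fourth_powers_nat:
  fixes x y z :: nat
  assumes "coprime x y" "y > 0" "z > 0"
  shows "y ^ 4 + z\<^sup>2 \<noteq> x ^ 4"
  using assms
proof (induction x arbitrary: y z rule: less_induct)
  case (less x)
  show ?case
  proof
    assume eq: "y ^ 4 + z\<^sup>2 = x ^ 4"
    have "x > 0" using eq less.prems by (auto intro!: Nat.gr0I)
    have eq2: "(y\<^sup>2)\<^sup>2 + z\<^sup>2 = (x\<^sup>2)\<^sup>2" using eq by (simp flip: power_mult)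
    have "coprime (z\<^sup>2 + (y\<^sup>2)\<^sup>2) ((y\<^sup>2)\<^sup>2)"
      using less.prems(1) eq2 by (simp add: add.commute)
    then have "coprime (z\<^sup>2) ((y\<^sup>2)\<^sup>2)" by (simp only: coprime_iff_gcd_eq_1 gcd_add1)
    then have cop: "coprime (y\<^sup>2) z" by (simp add: coprime_commute)
    have "even y \<or> even z"
      using odd_squares_sum_not_square_nat[of "y\<^sup>2" z] eq2 by (metis even_power)
    then show False
    proof
      assume "even z"
      obtain m n where mn: "coprime m n" "y\<^sup>2 + n\<^sup>2 = m\<^sup>2" "z = 2 * m * n" "x\<^sup>2 = m\<^sup>2 + n\<^sup>2"
        using cop \<open>even z\<close> eq2 by (metis pythagorean_triple_nat)
      have pos: "m > 0" "n > 0" using mn(3) less.prems by (auto intro!: Nat.gr0I)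
      \<comment> \<open>This is \<open>m^4 - n^4 = (m^2 - n^2) * (m^2 + n^2) = y^2 * x^2\<close>,
        arranged without subtraction.\<close>
      have "m ^ 4 = m\<^sup>2 * (y\<^sup>2 + n\<^sup>2)"
        unfolding mn(2) by (simp flip: power_add)
      also have "\<dots> = n ^ 4 + (m\<^sup>2 + n\<^sup>2) * y\<^sup>2"
        unfolding mn(2)[symmetric] by (simp add: eval_nat_numeral algebra_simps)
      finally have "n ^ 4 + (x * y)\<^sup>2 = m ^ 4"
        using mn(4) by (simp add: power_mult_distrib)
      moreover have "m\<^sup>2 < x\<^sup>2" using mn(4) pos by simp
      then have "m < x" by (simp add: power_less_imp_less_base)
      ultimately show False
        using less.IH[of m n "x * y"] mn(1) pos \<open>x > 0\<close> less.prems by simp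
    next
      assume "even y"
      obtain m n where mn: "coprime m n" "y\<^sup>2 = 2 * m * n" "x\<^sup>2 = m\<^sup>2 + n\<^sup>2" "odd (m + n)"
        using cop \<open>even y\<close> eq2
        by (metis pythagorean_triple_nat add.commute coprime_commute even_power zero_less_numeral)
      \<comment> \<open>Now \<open>(m, n, x)\<close> is itself a primitive triple, and either
        \<open>m\<close> or \<open>n\<close> may be its even leg. With \<open>n\<close> even,
        \<open>m\<close>, \<open>p\<close> and \<open>q\<close> are squares, so
        \<open>m + q^2 = p^2\<close> is again an equation of the original form.\<close>
      have descent: False
        if mn: "coprime m n" "y\<^sup>2 = 2 * m * n" "m\<^sup>2 + n\<^sup>2 = x\<^sup>2" and "even n" for m n
      proof -
        have pos: "m > 0" "n > 0" using mn(2) \<open>y > 0\<close> by (auto intro!: Nat.gr0I)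
        obtain s r where sr: "m = s\<^sup>2" "n = 2 * r\<^sup>2"
          using coprime_even_double_mult_eq_square_nat[OF mn(1) \<open>even n\<close> mn(2)] .
        obtain p q where pq: "coprime p q" "m + q\<^sup>2 = p\<^sup>2" "n = 2 * p * q" "x = p\<^sup>2 + q\<^sup>2"
          using mn(1,3) \<open>even n\<close> by (metis pythagorean_triple_nat)
        have "p * q = r\<^sup>2" using pq sr by simp
        with pq(1) obtain P Q where PQ: "p = P\<^sup>2" "q = Q\<^sup>2"
          by (rule coprime_mult_eq_square_nat)
        have "Q ^ 4 + s\<^sup>2 = P ^ 4"
          using pq(2) sr(1) PQ by (simp add: add.commute flip: power_mult)
        moreover have "coprime P Q" "Q > 0" "s > 0"
          using pq pos PQ sr by (auto intro!: Nat.gr0I)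
        moreover have "P < x"
        proof -
          have "P \<le> p" unfolding PQ(1) by (simp add: power2_eq_square)
          also have "p \<le> p\<^sup>2" by (simp add: power2_eq_square)
          also have "p\<^sup>2 < x" using pq(4) \<open>Q > 0\<close> PQ by simp
          finally show ?thesis .
        qed
        ultimately show False using less.IH by blast
      qed
      show False
        using descent[of m n] descent[of n m] mn
        by (auto simp: coprime_commute add.commute mult_ac)
    qed
  qed
qed

section \<open>Transfer to pairs whose product is a square\<close>

text \<open>Take \<open>g = gcd X Y\<close>: the coprime cofactors have product
  \<open>(w / g)^2\<close>, so each of them is a square.\<close>

lemma reduce_to_fourth_powers_nat:
  fixes X Y w :: nat
  assumes "X > 0" "Y > 0" "X * Y = w\<^sup>2"
  obtains g s t where "g > 0" "coprime s t" "s > 0" "t > 0" "X = g * s\<^sup>2" "Y = g * t\<^sup>2"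
proof -
  define g where "g = gcd X Y"
  obtain X' Y' where XY: "X = X' * g" "Y = Y' * g" "coprime X' Y'"
    using gcd_coprime_exists[of X Y] assms(1) unfolding g_def by auto
  have "g > 0" using assms(1) by (simp add: g_def)
  have "g\<^sup>2 * (X' * Y') = w\<^sup>2"
    using assms(3) XY by (simp add: power2_eq_square mult_ac)
  moreover from this have "g dvd w" by (metis dvd_triv_left pow_divides_pow_iff zero_less_numeral)
  then obtain v where "w = g * v" by blast
  ultimately have "X' * Y' = v\<^sup>2" using \<open>g > 0\<close> by (simp add: power_mult_distrib)
  with XY(3) obtain s t where st: "X' = s\<^sup>2" "Y' = t\<^sup>2"
    by (rule coprime_mult_eq_square_nat)
  show ?thesis
    by (rule that[of g s t]) (use XY st assms \<open>g > 0\<close> in \<open>auto intro!: Nat.gr0I\<close>)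
qed

text \<open>The reduction gives \<open>g^2 * (s^4 + t^4) = n^2\<close>; hence \<open>g\<close>
  divides \<open>n\<close> and cancels, leaving Fermat's equation.\<close>

lemma square_prod_sum_squares_not_square_nat:
  fixes X Y w n :: nat
  assumes "X > 0" "Y > 0" "X * Y = w\<^sup>2"
  shows "X\<^sup>2 + Y\<^sup>2 \<noteq> n\<^sup>2"
proof
  assume eq: "X\<^sup>2 + Y\<^sup>2 = n\<^sup>2"
  obtain g s t where g: "g > 0" "coprime s t" "s > 0" "t > 0" "X = g * s\<^sup>2" "Y = g * t\<^sup>2"
    using reduce_to_fourth_powers_nat[OF assms] .
  have "g\<^sup>2 * (s ^ 4 + t ^ 4) = n\<^sup>2"
    using eq g by (simp add: power_mult_distrib distrib_left flip: power_mult)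
  moreover from this have "g dvd n" by (metis dvd_triv_left pow_divides_pow_iff zero_less_numeral)
  then obtain v where "n = g * v" by blast
  ultimately have "s ^ 4 + t ^ 4 = v\<^sup>2" using g(1) by (simp add: power_mult_distrib)
  then show False using fermat_sum_fourth_powers_nat g by blast
qed

text \<open>The same cancellation of \<open>g\<close>, now for differences; \<open>n > 0\<close>
  excludes the trivial case \<open>X = Y\<close>.\<close>

lemma square_prod_diff_squares_not_square_nat:
  fixes X Y w n :: nat
  assumes "X > 0" "Y > 0" "X * Y = w\<^sup>2" "n > 0"
  shows "Y\<^sup>2 + n\<^sup>2 \<noteq> X\<^sup>2"
proof
  assume eq: "Y\<^sup>2 + n\<^sup>2 = X\<^sup>2"
  obtain g s t where g: "g > 0" "coprime s t" "s > 0" "t > 0" "X = g * s\<^sup>2" "Y = g * t\<^sup>2"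
    using reduce_to_fourth_powers_nat[OF assms(1-3)] .
  have eq': "g\<^sup>2 * t ^ 4 + n\<^sup>2 = g\<^sup>2 * s ^ 4"
    using eq g by (simp add: power_mult_distrib flip: power_mult)
  then have "g\<^sup>2 dvd n\<^sup>2" by (metis dvd_add_right_iff dvd_triv_left)
  then have "g dvd n" by simp
  then obtain v where v: "n = g * v" by blast
  with eq' have "g\<^sup>2 * (t ^ 4 + v\<^sup>2) = g\<^sup>2 * s ^ 4"
    by (simp add: power_mult_distrib distrib_left)
  then have "t ^ 4 + v\<^sup>2 = s ^ 4" using g(1) by simp
  then show False using fermat_diff_fourth_powers_nat g assms(4) v by fastforce
qed

section \<open>Rationality of \<open>n\<close> and conclusion\<close>

text \<open>The signed area \<open>A * B / 2\<close> equals
  \<open>n * (x^3 - n^2 * x) / y^2\<close>, and each curve equation makes the factor after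
  \<open>n\<close> equal to 1 or -1.\<close>

lemma rational_triangle_imp_Rats:
  assumes "rational_right_triangle_from n x y" "y\<^sup>2 = x ^ 3 - n\<^sup>2 * x \<or> y\<^sup>2 = n\<^sup>2 * x - x ^ 3"
  shows "n \<in> \<rat>"
proof -
  have y: "y \<noteq> 0" and rat: "tri_A n x y * tri_B n x y / 2 \<in> \<rat>"
    using assms(1) by (auto simp: rational_right_triangle_from_def)
  have "tri_A n x y * tri_B n x y / 2 = n * (x ^ 3 - n\<^sup>2 * x) / y\<^sup>2"
    using y by (simp add: tri_A_def tri_B_def field_simps power2_eq_square power3_eq_cube)
  moreover have "x ^ 3 - n\<^sup>2 * x = y\<^sup>2 \<or> x ^ 3 - n\<^sup>2 * x = - y\<^sup>2"
    using assms(2) by auto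
  ultimately have "tri_A n x y * tri_B n x y / 2 = n \<or> tri_A n x y * tri_B n x y / 2 = - n"
    using y by auto
  then show ?thesis using rat by auto
qed

lemma sqrt_of_nat_Rats_imp_square:
  assumes "sqrt (real N) \<in> \<rat>"
  obtains k :: nat where "N = k\<^sup>2"
proof -
  obtain p q :: nat where pq: "q \<noteq> 0" "\<bar>sqrt (real N)\<bar> = real p / real q"
    using Rats_abs_nat_div_natE[OF assms] by metis
  then have "real N = (real p / real q)\<^sup>2"
    by (metis power2_abs real_sqrt_pow2 of_nat_0_le_iff)
  then have "real (N * q\<^sup>2) = real (p\<^sup>2)"
    using pq(1) by (simp add: power_divide)
  then have eq: "N * q\<^sup>2 = p\<^sup>2" using of_nat_eq_iff by blast
  then have "q dvd p" by (metis dvd_triv_right pow_divides_pow_iff zero_less_numeral)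
  then obtain k where "p = q * k" by blast
  with eq pq(1) have "N = k\<^sup>2" by (simp add: power_mult_distrib)
  then show ?thesis by (rule that)
qed

theorem lemma1:
  fixes a b c d e f :: int and x2 y2 :: real
  assumes "a > 0" "b > 0" "c > 0" "d > 0" "e > 0" "f > 0"
    and "even a" "even b" "even c" "odd d" "odd e" "odd f"
    and "a\<^sup>2 + b\<^sup>2 = c\<^sup>2" "a\<^sup>2 + d\<^sup>2 = e\<^sup>2" "b\<^sup>2 + d\<^sup>2 = f\<^sup>2"
    and "x2 = sqrt ((real_of_int e + real_of_int d) / 2)"
    and "y2 = sqrt ((real_of_int e - real_of_int d) / 2)"
    and "x2 ^ 4 \<in> \<int>" "y2 ^ 4 \<in> \<int>"
  shows "(\<nexists>x y :: real. y\<^sup>2 = x ^ 3 - (x2 ^ 4 - y2 ^ 4) * x \<and>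
            rational_right_triangle_from (sqrt (x2 ^ 4 - y2 ^ 4)) x y) \<and>
         (\<nexists>x y :: real. y\<^sup>2 = (x2 ^ 4 + y2 ^ 4) * x - x ^ 3 \<and>
            rational_right_triangle_from (sqrt (x2 ^ 4 + y2 ^ 4)) x y)"
proof -
  have "d\<^sup>2 < e\<^sup>2" using assms(1,14) by (smt (verit) zero_less_power)
  then have "d < e" using assms(5) by (simp add: power_less_imp_less_base)
  have "even (e + d)" "even (e - d)" using assms by auto
  then obtain u v where uv: "e + d = 2 * u" "e - d = 2 * v" by blast
  obtain h where h: "a = 2 * h" using assms(7) by blast
  \<comment> \<open>\<open>X\<close> and \<open>Y\<close> are \<open>x2^2\<close> and
    \<open>y2^2\<close>, integral because \<open>d\<close> and \<open>e\<close> are both odd. With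
    \<open>w = a / 2\<close>, the equation \<open>a^2 = e^2 - d^2\<close> becomes
    \<open>X * Y = w^2\<close>.\<close>
  define X Y w where "X = nat u" and "Y = nat v" and "w = nat h"
  have XYw: "u = int X" "v = int Y" "h = int w"
    using uv h assms(1,4,5) \<open>d < e\<close> by (auto simp: X_def Y_def w_def)
  have pos: "Y > 0" "Y < X" using uv \<open>d < e\<close> assms(4) XYw by auto
  have "e = int X + int Y" "d = int X - int Y" using uv XYw by auto
  with assms(14) h XYw have "int (X * Y) = int (w\<^sup>2)"
    by (simp add: power2_eq_square algebra_simps)
  then have XY: "X * Y = w\<^sup>2" using of_nat_eq_iff by blast
  have "(real_of_int e + real_of_int d) / 2 = real X" "(real_of_int e - real_of_int d) / 2 = real Y"
    using uv XYw by (auto simp flip: of_int_add of_int_diff)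
  then have "x2\<^sup>2 = real X" "y2\<^sup>2 = real Y" using assms(16,17) by auto
  then have x2: "x2 ^ 4 = (real X)\<^sup>2" and y2: "y2 ^ 4 = (real Y)\<^sup>2"
    by (metis mult_2_right numeral_Bit0 power_mult)+
  \<comment> \<open>This makes the subtraction of naturals agree with the real one, and later forces
    \<open>n > 0\<close>.\<close>
  have lt: "Y\<^sup>2 < X\<^sup>2" using pos by (simp add: power_strict_mono)
  then have diff: "x2 ^ 4 - y2 ^ 4 = real (X\<^sup>2 - Y\<^sup>2)" using x2 y2 less_imp_le[OF lt] by (simp only: of_nat_diff of_nat_power)
  have sum: "x2 ^ 4 + y2 ^ 4 = real (X\<^sup>2 + Y\<^sup>2)" using x2 y2 by simp
  have "sqrt (real (X\<^sup>2 - Y\<^sup>2)) \<notin> \<rat>"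
  proof
    assume "sqrt (real (X\<^sup>2 - Y\<^sup>2)) \<in> \<rat>"
    then obtain n where n: "X\<^sup>2 - Y\<^sup>2 = n\<^sup>2" by (rule sqrt_of_nat_Rats_imp_square)
    then have "Y\<^sup>2 + n\<^sup>2 = X\<^sup>2" "n\<^sup>2 > 0" using lt by linarith+
    then have "Y\<^sup>2 + n\<^sup>2 = X\<^sup>2" "n > 0" by auto
    then show False using square_prod_diff_squares_not_square_nat XY pos by (metis less_trans)
  qed
  moreover have "sqrt (real (X\<^sup>2 + Y\<^sup>2)) \<notin> \<rat>"
    using square_prod_sum_squares_not_square_nat XY pos
    by (metis less_trans sqrt_of_nat_Rats_imp_square)
  moreover have "(sqrt (real N))\<^sup>2 = real N" for N by simp
  ultimately show ?thesis
    unfolding diff sum using rational_triangle_imp_Rats by metis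
qed

end
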